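(* Let $d\ge2$ be an integer, let $\varphi$ be the Laplace transform of a distribution function $G$ of a strictly positive random variable, and let $H$ be a max-infinitely divisible distribution function on $\mathbb{R}^d$. Let $F=\varphi\{-\log H\}$ be the distribution function of the $\varphi$-mixture of the max-infinitely divisible law with distribution function $H$. Then there exist a multivariate extremal process $\{Y(t),t>0\}$ governed by the law with distribution function $H$, and a random variable $Z>0$, independent of $\{Y(t),t>0\}$, with distribution function $G$ and Laplace transform $\varphi$, such that $F(x)=P\{Y(Z)\le x\}$ for all $x\in\mathbb{R}^d$.
   Context: A distribution function $H$ on $\mathbb{R}^d$ is max-infinitely divisible (MID) iff $H^s$ is a distribution function on $\mathbb{R}^d$ for every $s>0$. The Laplace transform of $G$ is $\varphi(v)=\int_0^\infty e^{-vs}\,dG(s)$, $v\ge0$. The $\varphi$-mixture of the MID law with distribution function $H$ is the law with distribution function $x\mapsto\varphi(-\log H(x))$, read as $0$ where $H(x)=0$. Inequalities, maxima and minima in $\mathbb{R}^d$ are componentwise. An extremal process governed by $H$ is an $\mathbb{R}^d$-valued process $\{Y(t),t>0\}$ with non-decreasing right-continuous paths whose finite-dimensional distributions are, for $0<t_1<\dots<t_m$ and $x_1,\dots,x_m\in\mathbb{R}^d$, $P\{Y(t_1)\le x_1,\dots,Y(t_m)\le x_m\}=H^{t_1}(x_1\wedge\dots\wedge x_m)\,H^{t_2-t_1}(x_2\wedge\dots\wedge x_m)\cdots H^{t_m-t_{m-1}}(x_m)$; in particular $P\{Y(t)\le x\}=H(x)^t=\exp\{t\log H(x)\}$. *)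

theory Defs
  imports "HOL-Probability.Probability"
begin

definition distribution_function :: "(real^'d \<Rightarrow> real) \<Rightarrow> bool" where
  "distribution_function H \<longleftrightarrow>
     (\<exists>N :: (real^'d) measure. prob_space N \<and> sets N = sets borel \<and> (\<forall>x. H x = measure N {..x}))"

definition max_infinitely_divisible :: "(real^'d \<Rightarrow> real) \<Rightarrow> bool" where
  "max_infinitely_divisible H \<longleftrightarrow>
     distribution_function H \<and> (\<forall>s>0. distribution_function (\<lambda>x. H x powr s))"

definition positive_distribution_function :: "(real \<Rightarrow> real) \<Rightarrow> bool" where
  "positive_distribution_function G \<longleftrightarrow>
     (\<exists>N. real_distribution N \<and> (AE z in N. z > 0) \<and> G = cdf N)"

text \<open>The integral \<open>\<integral>\<^sub>0\<^sup>\<infinity> e\<^bsup>-vs\<^esup> dG(s)\<close> is taken with respect to the Lebesgue--Stieltjes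
  measure of \<open>G\<close>.\<close>

definition laplace_transform :: "(real \<Rightarrow> real) \<Rightarrow> real \<Rightarrow> real" where
  "laplace_transform G v = (LINT s:{0..}|interval_measure G. exp (- v * s))"

definition mixture :: "(real \<Rightarrow> real) \<Rightarrow> (real^'d \<Rightarrow> real) \<Rightarrow> real^'d \<Rightarrow> real" where
  "mixture \<phi> H x = (if H x = 0 then 0 else \<phi> (- ln (H x)))"

text \<open>In the finite-dimensional distributions the times are \<open>t 1 < \<dots> < t m\<close>, and \<open>t 0 = 0\<close> is an
  auxiliary value that makes the first exponent \<open>t 1\<close> an instance of the general one. The time
  parameter ranges over the positive reals only; \<open>Y t\<close> is irrelevant for \<open>t \<le> 0\<close>.\<close>

definition extremal_process ::
  "'w measure \<Rightarrow> (real^'d \<Rightarrow> real) \<Rightarrow> (real \<Rightarrow> 'w \<Rightarrow> real^'d) \<Rightarrow> bool" where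
  "extremal_process M H Y \<longleftrightarrow>
     prob_space M \<and>
     (\<forall>t>0. Y t \<in> borel_measurable M) \<and>
     (\<forall>\<omega>\<in>space M. mono_on {0<..} (\<lambda>t. Y t \<omega>)) \<and>
     (\<forall>\<omega>\<in>space M. \<forall>t>0. continuous (at_right t) (\<lambda>s. Y s \<omega>)) \<and>
     (\<forall>m\<ge>1. \<forall>t :: nat \<Rightarrow> real. \<forall>x :: nat \<Rightarrow> real^'d.
        t 0 = 0 \<and> strict_mono_on {0..m} t \<longrightarrow>
        measure M {\<omega> \<in> space M. \<forall>k\<in>{1..m}. Y (t k) \<omega> \<le> x k} =
          (\<Prod>k=1..m. H (Inf_fin (x ` {k..m})) powr (t k - t (k - 1))))"

text \<open>Independence of a random variable and a whole process: the generated \<open>\<sigma>\<close>-algebras are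
  independent. The library's \<open>indep_var\<close> does not apply, as it forces both random elements to take
  values in the same type.\<close>

definition independent_of_process ::
  "'w measure \<Rightarrow> ('w \<Rightarrow> real) \<Rightarrow> (real \<Rightarrow> 'w \<Rightarrow> real^'d) \<Rightarrow> bool" where
  "independent_of_process M Z Y \<longleftrightarrow>
     prob_space.indep_set M
       (sigma_sets (space M) {Z -` A \<inter> space M | A. A \<in> sets borel})
       (sigma_sets (space M) {Y t -` B \<inter> space M | t B. t > 0 \<and> B \<in> sets borel})"

end

theory Submission
  imports Defs
begin

text \<open>
  For finitely many times \<open>0 < t\<^sub>1 < \<dots> < t\<^sub>m\<close> take independent \<open>X\<^sub>k\<close> with distribution functions
  \<open>H\<close> to the power \<open>t\<^sub>k - t\<^sub>k\<^sub>-\<^sub>1\<close>; their running maxima have the finite-dimensional law of an extremal process.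
  Dropping a time merges two powers of \<open>H\<close> at the same argument, so these laws are consistent and
  the Daniell--Kolmogorov theorem gives a process \<open>\<omega>(t)\<close>, \<open>t > 0\<close>, that is almost surely monotone
  along the rationals. Its regularization \<open>Y(t) = inf {\<omega>(q) | q > t rational}\<close> has monotone
  right-continuous paths, and it keeps the finite-dimensional laws because \<open>t \<mapsto> H(x)\<^sup>t\<close> is
  continuous. On the product with the law of \<open>G\<close>, Fubini gives
  \<open>P(Y(Z) \<le> x) = \<integral> H(x)\<^sup>z dG(z) = \<phi>(- log H(x))\<close>.
\<close>

subsection \<open>Lower orthants in Euclidean space\<close>

lemma borel_measurable_iff_atMost:
  fixes f :: "'b \<Rightarrow> 'a::ordered_euclidean_space"
  shows "f \<in> borel_measurable M \<longleftrightarrow> (\<forall>a. {\<omega> \<in> space M. f \<omega> \<le> a} \<in> sets M)"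
proof
  assume f: "f \<in> borel_measurable M"
  have "{\<omega> \<in> space M. f \<omega> \<le> a} = f -` {..a} \<inter> space M" for a by auto
  with f show "\<forall>a. {\<omega> \<in> space M. f \<omega> \<le> a} \<in> sets M" by (auto intro: measurable_sets)
next
  assume *: "\<forall>a. {\<omega> \<in> space M. f \<omega> \<le> a} \<in> sets M"
  show "f \<in> borel_measurable M"
    unfolding borel_eq_atMost
  proof (rule measurable_measure_of)
    fix y assume "y \<in> range (\<lambda>a. {..a::'a})"
    then obtain a where "y = {..a}" by blast
    then have "f -` y \<inter> space M = {\<omega> \<in> space M. f \<omega> \<le> a}" by auto
    with * show "f -` y \<inter> space M \<in> sets M" by simp
  qed auto
qed

text \<open>Supplies the countable exhaustion by lower orthants that generating a product
  sigma-algebra and uniqueness of measures both require.\<close>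

lemma UN_atMost_One: "(\<Union>n::nat. {..real n *\<^sub>R (One::'a::ordered_euclidean_space)}) = UNIV"
proof -
  have "\<exists>n::nat. x \<le> real n *\<^sub>R One" for x :: 'a
  proof -
    obtain n :: nat where "norm x \<le> real n" by (rule real_nat_ceiling_ge[THEN that])
    then have "x \<bullet> i \<le> real n" if "i \<in> Basis" for i
      using Basis_le_norm[OF that, of x] by linarith
    then show ?thesis by (auto simp: eucl_le[where 'a='a])
  qed
  then show ?thesis by auto
qed

text \<open>Products of lower orthants form an intersection-stable generator of the product
  sigma-algebra, so a joint distribution function determines the measure.\<close>

lemma measure_eqI_PiM_atMost:
  fixes M N :: "('i \<Rightarrow> 'a::ordered_euclidean_space) measure"
  assumes J: "finite J"
    and M: "finite_measure M" "sets M = sets (PiM J (\<lambda>_. borel))"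
    and N: "sets N = sets (PiM J (\<lambda>_. borel))"
    and eq: "\<And>x. emeasure M (\<Pi>\<^sub>E j\<in>J. {..x j}) = emeasure N (\<Pi>\<^sub>E j\<in>J. {..x j})"
  shows "M = N"
proof -
  interpret finite_measure M by fact
  let ?E = "range (\<lambda>x. \<Pi>\<^sub>E j\<in>J. {..x j::'a})"
  let ?\<Omega> = "\<Pi>\<^sub>E j\<in>J. (UNIV::'a set)"
  have "sets (PiM J (\<lambda>_. borel::'a measure)) = sets (PiM J (\<lambda>_. sigma UNIV (range atMost)))"
    by (intro sets_PiM_cong) (simp_all add: borel_eq_atMost[symmetric])
  also have "\<dots> = sets (sigma ?\<Omega> {{f\<in>?\<Omega>. \<forall>i\<in>j. f i \<in> A i} | A j. j \<in> {J} \<and> A \<in> Pi j (\<lambda>_. range atMost)})"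
  proof (rule sets_PiM_sigma)
    show "\<exists>S\<subseteq>range (atMost::'a \<Rightarrow> _). countable S \<and> UNIV = \<Union>S" for i
      by (rule exI[of _ "range (\<lambda>n::nat. {..real n *\<^sub>R (One::'a)})"]) (auto simp: UN_atMost_One)
  qed (use J in auto)
  \<comment> \<open>With \<open>J\<close> as the only index family, the generating cylinders are
    exactly the full orthant products.\<close>
  also have "{{f\<in>?\<Omega>. \<forall>i\<in>j. f i \<in> A i} | A j. j \<in> {J} \<and> A \<in> Pi j (\<lambda>_. range atMost)} = ?E"
  proof (intro set_eqI iffI)
    fix X assume "X \<in> {{f\<in>?\<Omega>. \<forall>i\<in>j. f i \<in> A i} | A j. j \<in> {J} \<and> A \<in> Pi j (\<lambda>_. range atMost)}"
    then obtain A where X: "X = {f\<in>?\<Omega>. \<forall>i\<in>J. f i \<in> A i}" and "\<forall>i\<in>J. \<exists>a. A i = {..a::'a}"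
      by (auto simp: Pi_iff image_iff)
    then obtain x where "\<And>i. i \<in> J \<Longrightarrow> A i = {..x i}" by metis
    with X have "X = (\<Pi>\<^sub>E j\<in>J. {..x j})" by (simp add: set_eq_iff PiE_iff conj_commute cong: ball_cong)
    then show "X \<in> ?E" by blast
  next
    fix X assume "X \<in> ?E"
    then obtain x where "X = (\<Pi>\<^sub>E j\<in>J. {..x j})" by blast
    then show "X \<in> {{f\<in>?\<Omega>. \<forall>i\<in>j. f i \<in> A i} | A j. j \<in> {J} \<and> A \<in> Pi j (\<lambda>_. range atMost)}"
      by (intro CollectI exI[of _ "\<lambda>j. {..x j}"] exI[of _ J])
        (auto simp: PiE_iff Pi_iff extensional_def)
  qed
  finally have sets: "sets (PiM J (\<lambda>_. borel::'a measure)) = sigma_sets ?\<Omega> ?E"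
    by (subst (asm) sets_measure_of) (auto simp: PiE_iff)
  show ?thesis
  proof (rule measure_eqI_generator_eq[where E = ?E and \<Omega> = ?\<Omega>
        and A = "\<lambda>n. \<Pi>\<^sub>E j\<in>J. {..real n *\<^sub>R One}"])
    show "Int_stable ?E"
    proof (rule Int_stableI_image)
      fix x y :: "'i \<Rightarrow> 'a"
      show "\<exists>z\<in>UNIV. (\<Pi>\<^sub>E j\<in>J. {..x j}) \<inter> (\<Pi>\<^sub>E j\<in>J. {..y j}) = (\<Pi>\<^sub>E j\<in>J. {..z j})"
        by (rule bexI[of _ "\<lambda>j. inf (x j) (y j)"]) (auto simp: PiE_iff)
    qed
    show "(\<Union>n. \<Pi>\<^sub>E j\<in>J. {..real n *\<^sub>R (One::'a)}) = ?\<Omega>"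
    proof (intro set_eqI iffI)
      fix f assume f: "f \<in> ?\<Omega>"
      have "\<forall>j. \<exists>n::nat. f j \<le> real n *\<^sub>R One"
        using UN_atMost_One[where 'a='a] by (simp add: set_eq_iff)
      from choice[OF this] obtain n :: "'i \<Rightarrow> nat" where n: "\<And>j. f j \<le> real (n j) *\<^sub>R One"
        by blast
      \<comment> \<open>Finiteness of \<open>J\<close> allows one bound for all coordinates.\<close>
      have "f j \<le> real (Max (n ` J)) *\<^sub>R One" if "j \<in> J" for j
      proof (rule order_trans[OF n])
        have "n j \<le> Max (n ` J)" using J that by simp
        then show "real (n j) *\<^sub>R (One::'a) \<le> real (Max (n ` J)) *\<^sub>R One"
          by (auto simp: eucl_le[where 'a='a])
      qed
      with f show "f \<in> (\<Union>n. \<Pi>\<^sub>E j\<in>J. {..real n *\<^sub>R (One::'a)})"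
        by (auto simp: PiE_iff)
    qed auto
    show "emeasure M (\<Pi>\<^sub>E j\<in>J. {..real n *\<^sub>R One}) \<noteq> \<infinity>" for n by simp
  qed (use M(2) N eq sets in auto)
qed

lemma sets_Collect_le_euclidean:
  fixes f g :: "'b \<Rightarrow> 'a::ordered_euclidean_space"
  assumes [measurable]: "f \<in> borel_measurable M" "g \<in> borel_measurable M"
  shows "{\<omega> \<in> space M. f \<omega> \<le> g \<omega>} \<in> sets M"
  unfolding eucl_le[where 'a='a] by measurable

lemma sets_Collect_ball_le:
  fixes X :: "'i \<Rightarrow> 'b \<Rightarrow> 'a::ordered_euclidean_space"
  assumes "finite J" "\<And>t. t \<in> J \<Longrightarrow> X t \<in> borel_measurable M"
  shows "{\<omega> \<in> space M. \<forall>t\<in>J. X t \<omega> \<le> x t} \<in> sets M"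
  using assms
  by (intro sets.sets_Collect_finite_All sets_Collect_le_euclidean borel_measurable_const) auto

lemma borel_measurable_coordinate:
  assumes "sets M = sets (PiM I (\<lambda>_. borel))" "t \<in> I"
  shows "(\<lambda>\<omega>. \<omega> t) \<in> borel_measurable M"
  using assms by (simp add: measurable_cong_sets[OF assms(1) refl] measurable_component_singleton)

subsection \<open>Products of powers along a finite set of times\<close>

text \<open>The exponent \<open>t k - t (k - 1)\<close>, read off from the set of times. Inserting 0
  makes 0 the predecessor of the least positive time and keeps \<open>Max\<close> off the empty
  set.\<close>

definition gap :: "real set \<Rightarrow> real \<Rightarrow> real" where
  "gap L s = s - Max (insert 0 {u \<in> L. u < s})"

lemma gap_pos: "finite L \<Longrightarrow> 0 < s \<Longrightarrow> 0 < gap L s"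
  by (auto simp: gap_def)

text \<open>The new time \<open>j\<close> splits the gap of its successor in two; equal bases at
  \<open>j\<close> and the successor let the exponents add up again. If \<open>j\<close> has no
  successor, its factor is 1.\<close>

lemma prod_powr_gap_insert:
  fixes h :: "real \<Rightarrow> real"
  assumes L: "finite L" "j \<notin> L" "0 < j"
    and next_eq: "\<And>s. s \<in> L \<Longrightarrow> j < s \<Longrightarrow> \<forall>u\<in>L. j < u \<longrightarrow> s \<le> u \<Longrightarrow> h j = h s"
    and last_eq: "\<forall>s\<in>L. s < j \<Longrightarrow> h j = 1"
  shows "(\<Prod>s\<in>insert j L. h s powr gap (insert j L) s) = (\<Prod>s\<in>L. h s powr gap L s)"
proof (cases "\<forall>s\<in>L. s < j")
  case True
  have "gap (insert j L) s = gap L s" if "s \<in> L" for s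
  proof -
    have "{u \<in> insert j L. u < s} = {u \<in> L. u < s}" using True that by force
    then show ?thesis by (simp add: gap_def)
  qed
  with True L last_eq show ?thesis by simp
next
  case False
  \<comment> \<open>The successor of \<open>j\<close>, the only old time whose gap changes.\<close>
  define n where "n = Min {u \<in> L. j < u}"
  have ne: "{u \<in> L. j < u} \<noteq> {}" using False L by (auto simp: not_less order.order_iff_strict)
  have "n \<in> {u \<in> L. j < u}" unfolding n_def by (rule Min_in) (use L ne in auto)
  then have n: "n \<in> L" "j < n" by auto
  have n_le: "n \<le> u" if "u \<in> L" "j < u" for u
    unfolding n_def using that L by auto
  have hj: "h j = h n" using next_eq n n_le by blast
  have gap_other: "gap (insert j L) s = gap L s" if "s \<in> L" "s \<noteq> n" for s
  proof (cases "s < j")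
    case True
    then have "{u \<in> insert j L. u < s} = {u \<in> L. u < s}" by auto
    then show ?thesis by (simp add: gap_def)
  next
    case False
    with that L n_le have "n < s" by (metis linorder_neqE_linordered_idom order.order_iff_strict)
    have "Max (insert 0 {u \<in> insert j L. u < s}) = Max (insert 0 {u \<in> L. u < s})"
    proof -
      have "insert 0 {u \<in> insert j L. u < s} = insert j (insert 0 {u \<in> L. u < s})"
        using \<open>n < s\<close> n by auto
      moreover have "j \<le> Max (insert 0 {u \<in> L. u < s})"
        using \<open>n < s\<close> n L by (subst Max_ge_iff) (auto intro!: bexI[of _ n])
      ultimately show ?thesis using L by (simp add: max_absorb2)
    qed
    then show ?thesis by (simp add: gap_def)
  qed
  have gap_n: "gap L n = gap (insert j L) j + gap (insert j L) n"
  proof -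
    have "{u \<in> insert j L. u < j} = {u \<in> L. u < n}"
      using n n_le L by (auto simp: set_eq_iff) (metis linorder_neqE_linordered_idom not_less)
    moreover have "Max (insert 0 {u \<in> insert j L. u < n}) = j"
      using n n_le L by (intro Max_eqI) force+
    ultimately show ?thesis by (simp add: gap_def)
  qed
  have "(\<Prod>s\<in>insert j L. h s powr gap (insert j L) s) =
      h j powr gap (insert j L) j * (h n powr gap (insert j L) n *
        (\<Prod>s\<in>L - {n}. h s powr gap (insert j L) s))"
    using L n by (simp add: prod.remove)
  also have "\<dots> = h n powr gap L n * (\<Prod>s\<in>L - {n}. h s powr gap L s)"
    by (simp add: gap_n powr_add hj gap_other)
  finally show ?thesis using L n by (simp add: prod.remove)
qed

text \<open>If no index of \<open>J\<close> lies above \<open>s\<close> there is no constraint, whence the value 1.\<close>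

definition upper_value ::
  "('a::semilattice_inf \<Rightarrow> real) \<Rightarrow> real set \<Rightarrow> (real \<Rightarrow> 'a) \<Rightarrow> real \<Rightarrow> real" where
  "upper_value H J x s =
     (if \<exists>t\<in>J. s \<le> t then H (Inf_fin (x ` {t \<in> J. s \<le> t})) else 1)"

text \<open>Consistency in numerical form: a time outside \<open>J\<close> carries no bound of its
  own, so its base is that of the next time, or 1 if there is none, and it can be inserted without
  changing the product.\<close>

lemma prod_powr_gap_superset:
  assumes "finite L" "J \<subseteq> L" "L \<subseteq> {0<..}"
  shows "(\<Prod>s\<in>L. upper_value H J x s powr gap L s) = (\<Prod>s\<in>J. upper_value H J x s powr gap J s)"
proof -
  \<comment> \<open>The bounds stay those of \<open>J\<close> throughout; only the gaps change as
    the times of \<open>K\<close> are added one by one.\<close>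
  have "(\<Prod>s\<in>J \<union> K. upper_value H J x s powr gap (J \<union> K) s)
      = (\<Prod>s\<in>J. upper_value H J x s powr gap J s)" if "K \<subseteq> L - J" for K
    using finite_subset[OF that finite_Diff[OF assms(1)]] that
  proof (induction K rule: finite_induct)
    case (insert j K)
    have "(\<Prod>s\<in>insert j (J \<union> K). upper_value H J x s powr gap (insert j (J \<union> K)) s)
      = (\<Prod>s\<in>J \<union> K. upper_value H J x s powr gap (J \<union> K) s)"
    proof (rule prod_powr_gap_insert)
      fix s assume s: "s \<in> J \<union> K" "j < s" "\<forall>u\<in>J \<union> K. j < u \<longrightarrow> s \<le> u"
      then have "{t \<in> J. j \<le> t} = {t \<in> J. s \<le> t}"
        using insert.prems by (auto simp: order.order_iff_strict)
      then show "upper_value H J x j = upper_value H J x s"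
        unfolding upper_value_def by (smt (verit) Collect_empty_eq mem_Collect_eq)
    next
      assume "\<forall>s\<in>J \<union> K. s < j"
      then show "upper_value H J x j = 1"
        by (auto simp: upper_value_def dest: bspec)
    qed (use insert assms in \<open>auto intro: finite_subset\<close>)
    with insert show ?case by simp
  qed simp
  from this[of "L - J"] show ?thesis using assms by (simp add: Un_absorb1)
qed

subsection \<open>The projective limit of the running maxima\<close>

text \<open>For positive \<open>s\<close> and \<open>t\<close> the maximum of independent variables
  with laws \<open>\<mu> s\<close> and \<open>\<mu> t\<close> has law \<open>\<mu> (s + t)\<close>,
  whence the name. For \<open>s \<le> 0\<close> only some probability measure is asked for, so that
  products over arbitrary index sets are probability spaces.\<close>

locale max_convolution_semigroup =
  fixes \<mu> :: "real \<Rightarrow> 'a::ordered_euclidean_space measure" and H :: "'a \<Rightarrow> real"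
  assumes prob_space_mu: "prob_space (\<mu> s)"
    and sets_mu [measurable_cong, simp]: "sets (\<mu> s) = sets borel"
    and measure_mu: "0 < s \<Longrightarrow> measure (\<mu> s) {..x} = H x powr s"
begin

lemma space_mu [simp]: "space (\<mu> s) = UNIV"
  using sets_eq_imp_space_eq[OF sets_mu] by simp

definition increments :: "real set \<Rightarrow> (real \<Rightarrow> 'a) measure" where
  "increments L = PiM L (\<lambda>s. \<mu> (gap L s))"

text \<open>The restriction to \<open>L\<close> makes the result a point of the product space over
  \<open>L\<close>, whose functions are \<open>undefined\<close> outside \<open>L\<close>.\<close>

definition running_sup :: "real set \<Rightarrow> (real \<Rightarrow> 'a) \<Rightarrow> real \<Rightarrow> 'a" where
  "running_sup L \<omega> = (\<lambda>t\<in>L. Sup_fin (\<omega> ` {s \<in> L. s \<le> t}))"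

definition fidi :: "real set \<Rightarrow> (real \<Rightarrow> 'a) measure" where
  "fidi L = distr (increments L) (PiM L (\<lambda>_. borel)) (running_sup L)"

lemma sets_increments [measurable_cong, simp]: "sets (increments L) = sets (PiM L (\<lambda>_. borel))"
  unfolding increments_def by (intro sets_PiM_cong) simp_all

lemma space_increments [simp]: "space (increments L) = (\<Pi>\<^sub>E t\<in>L. UNIV)"
  by (simp add: increments_def space_PiM)

lemma sets_fidi [measurable_cong, simp]: "sets (fidi L) = sets (PiM L (\<lambda>_. borel))"
  by (simp add: fidi_def)

lemma space_fidi [simp]: "space (fidi L) = (\<Pi>\<^sub>E t\<in>L. UNIV)"
  by (simp add: fidi_def space_PiM)

lemma running_sup_le_iff:
  assumes "finite L" "t \<in> L"
  shows "running_sup L \<omega> t \<le> a \<longleftrightarrow> (\<forall>s\<in>L. s \<le> t \<longrightarrow> \<omega> s \<le> a)"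
  using assms unfolding running_sup_def by (subst restrict_apply', simp, subst Sup_fin.bounded_iff) auto

lemma running_sup_mono:
  assumes "finite L" "s \<in> L" "t \<in> L" "s \<le> t"
  shows "running_sup L \<omega> s \<le> running_sup L \<omega> t"
  using assms running_sup_le_iff[of L t \<omega> "running_sup L \<omega> t"]
  by (auto simp: running_sup_le_iff)

text \<open>That a finite supremum stays below \<open>a\<close> is a finite intersection of
  coordinate events.\<close>

lemma measurable_running_sup [measurable]:
  assumes L: "finite L"
  shows "running_sup L \<in> increments L \<rightarrow>\<^sub>M PiM L (\<lambda>_. borel)"
  unfolding running_sup_def
proof (rule measurable_restrict)
  fix t assume t: "t \<in> L"
  show "(\<lambda>\<omega>. Sup_fin (\<omega> ` {s \<in> L. s \<le> t})) \<in> borel_measurable (increments L)"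
    unfolding borel_measurable_iff_atMost
  proof
    fix a
    have "{\<omega> \<in> space (increments L). \<forall>s\<in>{s\<in>L. s \<le> t}. \<omega> s \<le> a} \<in> sets (increments L)"
      using L by (intro sets_Collect_ball_le borel_measurable_coordinate[OF sets_increments]) auto
    also have "{\<omega> \<in> space (increments L). \<forall>s\<in>{s\<in>L. s \<le> t}. \<omega> s \<le> a}
      = {\<omega> \<in> space (increments L). Sup_fin (\<omega> ` {s \<in> L. s \<le> t}) \<le> a}"
      using running_sup_le_iff[OF L t] t by (auto simp: running_sup_def)
    finally show "{\<omega> \<in> space (increments L). Sup_fin (\<omega> ` {s \<in> L. s \<le> t}) \<le> a} \<in> sets (increments L)" .
  qed
qed

lemma prob_space_increments: "prob_space (increments L)"
  unfolding increments_def by (intro prob_space_PiM prob_space_mu)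

lemma prob_space_fidi: "finite L \<Longrightarrow> prob_space (fidi L)"
  unfolding fidi_def by (intro prob_space.prob_space_distr prob_space_increments measurable_running_sup)

text \<open>The bounds at the times of \<open>J\<close> confine each increment separately, so the
  event is a box and its probability factors; the times of \<open>L\<close> outside \<open>J\<close>
  then drop out by \<open>prod_powr_gap_superset\<close>.\<close>

lemma measure_fidi:
  assumes L: "finite L" "L \<subseteq> {0<..}" and J: "J \<subseteq> L"
  shows "measure (fidi L) {\<omega> \<in> space (fidi L). \<forall>t\<in>J. \<omega> t \<le> x t} =
    (\<Prod>s\<in>J. upper_value H J x s powr gap J s)"
proof -
  interpret S: finite_product_prob_space "\<lambda>s. \<mu> (gap L s)" L
  proof -
    interpret prob_space "\<mu> s" for s by (rule prob_space_mu)
    show "finite_product_prob_space (\<lambda>s. \<mu> (gap L s)) L"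
      by standard (rule L)
  qed
  let ?A = "\<lambda>s. {y. \<forall>t\<in>J. s \<le> t \<longrightarrow> y \<le> x t}"
  have fin: "finite J" using L J finite_subset by auto
  \<comment> \<open>Increments later than all of \<open>J\<close> are unconstrained; the case split
    also avoids \<open>Inf_fin\<close> of the empty set.\<close>
  have A: "?A s = (if \<exists>t\<in>J. s \<le> t then {..Inf_fin (x ` {t \<in> J. s \<le> t})} else UNIV)" for s
  proof (cases "\<exists>t\<in>J. s \<le> t")
    case True
    then have "y \<le> Inf_fin (x ` {t \<in> J. s \<le> t}) \<longleftrightarrow> y \<in> ?A s" for y
      using fin by (subst Inf_fin.bounded_iff) auto
    then show ?thesis using True by auto
  qed auto
  have "{\<omega> \<in> space (fidi L). \<forall>t\<in>J. \<omega> t \<le> x t} \<in> sets (fidi L)"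
    using fin J by (intro sets_Collect_ball_le borel_measurable_coordinate[OF sets_fidi]) auto
  then have "measure (fidi L) {\<omega> \<in> space (fidi L). \<forall>t\<in>J. \<omega> t \<le> x t} =
      measure (increments L) (running_sup L -` {\<omega> \<in> space (fidi L). \<forall>t\<in>J. \<omega> t \<le> x t} \<inter> space (increments L))"
    unfolding fidi_def using L by (subst measure_distr) auto
  also have "running_sup L -` {\<omega> \<in> space (fidi L). \<forall>t\<in>J. \<omega> t \<le> x t} \<inter> space (increments L)
      = (\<Pi>\<^sub>E s\<in>L. ?A s)"
  proof (rule set_eqI)
    fix \<omega>
    have "(\<forall>t\<in>J. running_sup L \<omega> t \<le> x t) \<longleftrightarrow> (\<forall>t\<in>J. \<forall>s\<in>L. s \<le> t \<longrightarrow> \<omega> s \<le> x t)"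
      using J by (intro ball_cong refl running_sup_le_iff[OF L(1)]) auto
    moreover have "running_sup L \<omega> \<in> space (fidi L)"
      by (simp add: running_sup_def)
    ultimately show "\<omega> \<in> running_sup L -` {\<omega> \<in> space (fidi L). \<forall>t\<in>J. \<omega> t \<le> x t} \<inter> space (increments L)
        \<longleftrightarrow> \<omega> \<in> (\<Pi>\<^sub>E s\<in>L. ?A s)"
      unfolding vimage_Collect_eq PiE_iff Int_iff mem_Collect_eq space_increments by blast
  qed
  also have "measure (increments L) (\<Pi>\<^sub>E s\<in>L. ?A s) = (\<Prod>s\<in>L. measure (\<mu> (gap L s)) (?A s))"
    unfolding increments_def by (rule S.prob_times) (auto simp: A)
  also have "\<dots> = (\<Prod>s\<in>L. upper_value H J x s powr gap L s)"
  proof (rule prod.cong[OF refl])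
    fix s assume "s \<in> L"
    then have "0 < gap L s" using L by (intro gap_pos) auto
    moreover have "measure (\<mu> r) UNIV = 1" for r
      using prob_space.prob_space[OF prob_space_mu[of r]] by simp
    ultimately show "measure (\<mu> (gap L s)) (?A s) = upper_value H J x s powr gap L s"
      unfolding A by (auto simp: upper_value_def measure_mu)
  qed
  also have "\<dots> = (\<Prod>s\<in>J. upper_value H J x s powr gap J s)"
    by (rule prod_powr_gap_superset) (use L J in auto)
  finally show ?thesis .
qed

text \<open>By \<open>measure_fidi\<close> the probability of an orthant product over
  \<open>J\<close> does not depend on the superset \<open>L\<close>, and orthant products determine
  the measure.\<close>

lemma fidi_consistent:
  assumes L: "finite L" "L \<subseteq> {0<..}" and J: "J \<subseteq> L"
  shows "fidi J = distr (fidi L) (PiM J (\<lambda>_. borel)) (\<lambda>f. restrict f J)"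
proof -
  have fin: "finite J" using L J finite_subset by auto
  interpret FJ: prob_space "fidi J" by (rule prob_space_fidi) fact
  interpret FL: prob_space "fidi L" by (rule prob_space_fidi) fact
  have res [measurable]: "(\<lambda>f. restrict f J) \<in> fidi L \<rightarrow>\<^sub>M PiM J (\<lambda>_. borel)"
    using J by (simp add: measurable_cong_sets[OF sets_fidi refl] measurable_restrict_subset)
  interpret D: prob_space "distr (fidi L) (PiM J (\<lambda>_. borel)) (\<lambda>f. restrict f J)"
    by (rule FL.prob_space_distr) fact
  show ?thesis
  proof (rule measure_eqI_PiM_atMost)
    fix x :: "real \<Rightarrow> 'a"
    have J_eq: "(\<Pi>\<^sub>E j\<in>J. {..x j}) = {\<omega> \<in> space (fidi J). \<forall>t\<in>J. \<omega> t \<le> x t}"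
      by (simp add: set_eq_iff PiE_iff conj_commute)
    have L_eq: "(\<lambda>f. restrict f J) -` (\<Pi>\<^sub>E j\<in>J. {..x j}) \<inter> space (fidi L)
        = {\<omega> \<in> space (fidi L). \<forall>t\<in>J. \<omega> t \<le> x t}"
      unfolding set_eq_iff Int_iff vimage_eq restrict_PiE_iff mem_Collect_eq atMost_iff by blast
    have "measure (fidi J) (\<Pi>\<^sub>E j\<in>J. {..x j}) = measure (fidi L) {\<omega> \<in> space (fidi L). \<forall>t\<in>J. \<omega> t \<le> x t}"
      unfolding J_eq measure_fidi[OF fin order_trans[OF J L(2)] order_refl] measure_fidi[OF L J] ..
    also have "\<dots> = measure (distr (fidi L) (PiM J (\<lambda>_. borel)) (\<lambda>f. restrict f J)) (\<Pi>\<^sub>E j\<in>J. {..x j})"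
      unfolding L_eq[symmetric] using fin
      by (subst measure_distr) (auto intro!: sets_PiM_I_finite)
    finally show "emeasure (fidi J) (\<Pi>\<^sub>E j\<in>J. {..x j}) =
        emeasure (distr (fidi L) (PiM J (\<lambda>_. borel)) (\<lambda>f. restrict f J)) (\<Pi>\<^sub>E j\<in>J. {..x j})"
      by (simp add: FJ.emeasure_eq_measure D.emeasure_eq_measure)
  qed (use fin FJ.finite_measure_axioms in auto)
qed

text \<open>Daniell--Kolmogorov: \<open>K.lim\<close> is the measure on functions over the positive
  reals with marginals \<open>fidi J\<close> for finite \<open>J\<close>.\<close>

sublocale K: polish_projective "{0<..}" fidi
  by (intro polish_projective.intro projective_family.intro fidi_consistent prob_space_fidi)

text \<open>Assumption \<open>Q\<close> says that the event only looks at the times in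
  \<open>J\<close>, so it is a cylinder over \<open>J\<close>.\<close>

lemma measure_lim_restrict:
  assumes J: "finite J" "J \<subseteq> {0<..}" and A: "{\<omega> \<in> space (fidi J). Q \<omega>} \<in> sets (fidi J)"
    and Q: "\<And>\<omega>. Q (restrict \<omega> J) \<longleftrightarrow> Q \<omega>"
  shows "measure K.lim {\<omega> \<in> space K.lim. Q \<omega>} = measure (fidi J) {\<omega> \<in> space (fidi J). Q \<omega>}"
proof -
  have "prod_emb {0<..} (\<lambda>_. borel) J {\<omega> \<in> space (fidi J). Q \<omega>} = {\<omega> \<in> space K.lim. Q \<omega>}"
    by (simp add: set_eq_iff prod_emb_def space_PiM PiE_iff Q conj_commute)
  with K.measure_lim_emb[OF J(2,1), of "{\<omega> \<in> space (fidi J). Q \<omega>}"] A show ?thesis by simp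
qed

lemma measure_lim_atMost:
  assumes J: "finite J" "J \<subseteq> {0<..}"
  shows "measure K.lim {\<omega> \<in> space K.lim. \<forall>t\<in>J. \<omega> t \<le> x t} =
    (\<Prod>s\<in>J. upper_value H J x s powr gap J s)"
proof -
  have "{\<omega> \<in> space (fidi J). \<forall>t\<in>J. \<omega> t \<le> x t} \<in> sets (fidi J)"
    using J by (intro sets_Collect_ball_le borel_measurable_coordinate[OF sets_fidi]) auto
  then show ?thesis
    unfolding measure_fidi[OF J order_refl, symmetric] by (rule measure_lim_restrict[OF J]) simp
qed

text \<open>Running maxima are monotone at every sample point, so the two-time marginal gives the
  event probability 1, and the cylinder in the limit inherits it.\<close>

lemma AE_lim_mono:
  assumes "0 < s" "s \<le> t"
  shows "AE \<omega> in K.lim. \<omega> s \<le> \<omega> t"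
proof -
  let ?J = "{s, t}"
  have J: "finite ?J" "?J \<subseteq> {0<..}" using assms by auto
  have meas: "{\<omega> \<in> space (fidi ?J). \<omega> s \<le> \<omega> t} \<in> sets (fidi ?J)"
    by (intro sets_Collect_le_euclidean) measurable
  have "AE \<omega> in fidi ?J. \<omega> s \<le> \<omega> t"
    unfolding fidi_def
  proof (subst AE_distr_iff)
    show "{\<omega> \<in> space (PiM ?J (\<lambda>_. borel)). \<omega> s \<le> \<omega> t} \<in> sets (PiM ?J (\<lambda>_. borel::'a measure))"
      using meas by (simp add: space_PiM)
  qed (use assms in \<open>auto intro!: running_sup_mono\<close>)
  then have "measure (fidi ?J) {\<omega> \<in> space (fidi ?J). \<omega> s \<le> \<omega> t} = 1"
    using prob_space.prob_Collect_eq_1[OF prob_space_fidi meas] by simp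
  then have "measure K.lim {\<omega> \<in> space K.lim. \<omega> s \<le> \<omega> t} = 1"
    by (subst measure_lim_restrict[OF J meas]) auto
  then show ?thesis by (rule K.P.AE_prob_1[THEN AE_mp]) auto
qed

end

subsection \<open>Right-continuous regularization\<close>

text \<open>The value \<open>0\<close> on paths that are not monotone along the rationals keeps every path monotone and
  right-continuous.\<close>

definition regularize :: "(real \<Rightarrow> 'a::ordered_euclidean_space) \<Rightarrow> real \<Rightarrow> 'a" where
  "regularize \<omega> t = (if mono_on (\<rat> \<inter> {0<..}) \<omega> then (INF q\<in>\<rat> \<inter> {t<..}. \<omega> q) else 0)"

lemma regularize_not_mono: "\<not> mono_on (\<rat> \<inter> {0<..}) \<omega> \<Longrightarrow> regularize \<omega> = (\<lambda>_. 0)"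
  by (simp add: regularize_def fun_eq_iff)

lemma rats_greater_nonempty: "\<rat> \<inter> {t::real<..} \<noteq> {}"
  using Rats_dense_in_real[of t "t + 1"] by auto

context
  fixes \<omega> :: "real \<Rightarrow> 'a::ordered_euclidean_space"
  assumes mono: "mono_on (\<rat> \<inter> {0<..}) \<omega>"
begin

lemma bdd_below_rats_greater:
  assumes "0 < t"
  shows "bdd_below (\<omega> ` (\<rat> \<inter> {t<..}))"
proof -
  obtain p where "p \<in> \<rat>" "0 < p" "p < t" using Rats_dense_in_real[OF assms] by auto
  then have "\<omega> p \<le> \<omega> q" if "q \<in> \<rat> \<inter> {t<..}" for q
    using that by (intro mono_onD[OF mono]) auto
  then show ?thesis by (rule bdd_belowI2)
qed

lemma regularize_le: "0 < t \<Longrightarrow> q \<in> \<rat> \<Longrightarrow> t < q \<Longrightarrow> regularize \<omega> t \<le> \<omega> q"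
  using mono unfolding regularize_def by (auto intro!: cINF_lower bdd_below_rats_greater)

lemma regularize_greatest: "(\<And>q. q \<in> \<rat> \<Longrightarrow> t < q \<Longrightarrow> a \<le> \<omega> q) \<Longrightarrow> a \<le> regularize \<omega> t"
  using mono rats_greater_nonempty[of t] unfolding regularize_def by (auto intro!: cINF_greatest)

text \<open>Infima are taken coordinatewise, so a single rational time witnesses the inequality.
  Both right continuity and measurability rest on this.\<close>

lemma regularize_inner_less_iff:
  assumes "0 < t" "i \<in> Basis"
  shows "regularize \<omega> t \<bullet> i < a \<longleftrightarrow> (\<exists>q\<in>\<rat> \<inter> {t<..}. \<omega> q \<bullet> i < a)"
proof -
  have "bdd_below ((\<lambda>q. \<omega> q \<bullet> i) ` (\<rat> \<inter> {t<..}))"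
    using bdd_below_rats_greater[OF \<open>0 < t\<close>] \<open>i \<in> Basis\<close>
    by (force simp: bdd_below_def eucl_le[where 'a='a])
  then show ?thesis
    using mono assms rats_greater_nonempty[of t] unfolding regularize_def
    by (simp add: inner_Basis_INF_left cINF_less_iff)
qed

end

lemma mono_on_regularize: "mono_on {0<..} (regularize \<omega>)"
proof (cases "mono_on (\<rat> \<inter> {0<..}) \<omega>")
  case True
  show ?thesis
    by (rule mono_onI, rule regularize_greatest[OF True]) (auto intro!: regularize_le[OF True])
qed (simp add: regularize_not_mono monotone_on_def)

text \<open>Convergence is checked coordinatewise: monotonicity gives the lower bound, and a
  rational \<open>q > t\<close> witnessing a value below \<open>a\<close> serves for all
  \<open>s\<close> between \<open>t\<close> and \<open>q\<close>.\<close>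

lemma continuous_at_right_regularize:
  assumes "0 < t"
  shows "continuous (at_right t) (regularize \<omega>)"
proof (cases "mono_on (\<rat> \<inter> {0<..}) \<omega>")
  case True
  have "((\<lambda>s. regularize \<omega> s \<bullet> i) \<longlongrightarrow> regularize \<omega> t \<bullet> i) (at_right t)" if i: "i \<in> Basis" for i
  proof (rule order_tendstoI)
    fix a assume a: "a < regularize \<omega> t \<bullet> i"
    have "a < regularize \<omega> s \<bullet> i" if "t < s" for s
    proof -
      have "regularize \<omega> t \<le> regularize \<omega> s"
        using that assms by (intro mono_onD[OF mono_on_regularize]) auto
      with a i show ?thesis by (auto simp: eucl_le[where 'a='a] intro: less_le_trans)
    qed
    then show "\<forall>\<^sub>F s in at_right t. a < regularize \<omega> s \<bullet> i"
      by (auto simp: eventually_at_filter)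
  next
    fix a assume "regularize \<omega> t \<bullet> i < a"
    then obtain q where q: "q \<in> \<rat>" "t < q" "\<omega> q \<bullet> i < a"
      using regularize_inner_less_iff[OF True assms i] by auto
    have "regularize \<omega> s \<bullet> i < a" if "t < s" "s < q" for s
      using that assms i q by (auto simp: regularize_inner_less_iff[OF True])
    then show "\<forall>\<^sub>F s in at_right t. regularize \<omega> s \<bullet> i < a"
      using q by (auto simp: eventually_at_right[OF q(2)])
  qed
  then show ?thesis
    unfolding continuous_within by (subst tendsto_componentwise_iff) blast
qed (simp add: regularize_not_mono)

lemma sets_mono_on_countable:
  fixes X :: "'i::order \<Rightarrow> 'b \<Rightarrow> 'a::ordered_euclidean_space"
  assumes "countable I" "\<And>q. q \<in> I \<Longrightarrow> X q \<in> borel_measurable M"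
  shows "{\<omega> \<in> space M. mono_on I (\<lambda>q. X q \<omega>)} \<in> sets M"
proof -
  have "Measurable.pred M (\<lambda>\<omega>. \<forall>p\<in>I. \<forall>q\<in>I. p \<le> q \<longrightarrow> X p \<omega> \<le> X q \<omega>)"
    using assms
    by (intro measurable_pred_countable pred_intros_logic)
      (auto simp: pred_def intro!: sets_Collect_le_euclidean)
  then show ?thesis by (simp add: pred_def monotone_on_def)
qed

text \<open>The event for one coordinate is a countable combination over rational times. The time
  \<open>T\<close> may be random, so both fixed times and the process at the time \<open>Z\<close>
  are covered.\<close>

lemma borel_measurable_regularize:
  fixes X :: "real \<Rightarrow> 'b \<Rightarrow> 'a::ordered_euclidean_space"
  assumes X [measurable]: "\<And>q. 0 < q \<Longrightarrow> X q \<in> borel_measurable M"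
    and T [measurable]: "T \<in> borel_measurable M" and T_pos: "\<And>\<omega>. \<omega> \<in> space M \<Longrightarrow> 0 < T \<omega>"
  shows "(\<lambda>\<omega>. regularize (\<lambda>q. X q \<omega>) (T \<omega>)) \<in> borel_measurable M"
proof (subst borel_measurable_euclidean_space, intro ballI, unfold borel_measurable_iff_less, intro allI)
  fix i :: 'a and a :: real assume i: "i \<in> Basis"
  let ?Q = "\<rat> \<inter> {0<..} :: real set"
  let ?mono = "\<lambda>\<omega>. mono_on ?Q (\<lambda>q. X q \<omega>)"
  have Q: "countable ?Q" by (simp add: countable_rat countable_Int1)
  have [measurable]: "Measurable.pred M ?mono"
    unfolding pred_def by (rule sets_mono_on_countable[OF Q]) auto
  have [measurable]: "Measurable.pred M (\<lambda>\<omega>. \<exists>q\<in>?Q. T \<omega> < q \<and> X q \<omega> \<bullet> i < a)"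
    using Q by (intro measurable_pred_countable) auto
  have "regularize (\<lambda>q. X q \<omega>) (T \<omega>) \<bullet> i < a \<longleftrightarrow>
      (?mono \<omega> \<and> (\<exists>q\<in>?Q. T \<omega> < q \<and> X q \<omega> \<bullet> i < a)) \<or> (\<not> ?mono \<omega> \<and> 0 < a)" if "\<omega> \<in> space M" for \<omega>
  proof (cases "?mono \<omega>")
    case True
    then show ?thesis
      using T_pos[OF that] i by (auto simp: regularize_inner_less_iff intro: less_trans)
  qed (simp add: regularize_def)
  then have "{\<omega> \<in> space M. regularize (\<lambda>q. X q \<omega>) (T \<omega>) \<bullet> i < a} = {\<omega> \<in> space M.
      (?mono \<omega> \<and> (\<exists>q\<in>?Q. T \<omega> < q \<and> X q \<omega> \<bullet> i < a)) \<or> (\<not> ?mono \<omega> \<and> 0 < a)}"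
    by auto
  also have "\<dots> \<in> sets M" by measurable
  finally show "{\<omega> \<in> space M. regularize (\<lambda>q. X q \<omega>) (T \<omega>) \<bullet> i < a} \<in> sets M" .
qed

text \<open>For \<open>b \<noteq> 0\<close> this is right continuity of the exponent function; for
  \<open>b = 0\<close> the power is 0 and \<open>0 \<le> c\<close> applies.\<close>

lemma powr_le_of_rats_greater:
  fixes b c t :: real
  assumes le: "\<And>q. q \<in> \<rat> \<Longrightarrow> t < q \<Longrightarrow> b powr q \<le> c" and "0 \<le> c"
  shows "b powr t \<le> c"
proof (cases "b = 0")
  case False
  show ?thesis
  proof (rule ccontr)
    assume "\<not> b powr t \<le> c"
    moreover have "((\<lambda>q. b powr q) \<longlongrightarrow> b powr t) (at_right t)"
      using False by (intro tendsto_powr tendsto_const tendsto_ident_at) auto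
    ultimately have "\<forall>\<^sub>F q in at_right t. c < b powr q"
      by (intro order_tendstoD(1)) auto
    then obtain u where u: "t < u" "\<And>q. t < q \<Longrightarrow> q < u \<Longrightarrow> c < b powr q"
      by (auto simp: eventually_at_right[OF less_add_one[of t]])
    obtain q where "q \<in> \<rat>" "t < q" "q < u" using Rats_dense_in_real[OF u(1)] by auto
    with le[of q] u(2)[of q] show False by simp
  qed
qed (use assms in simp)

section \<open>Finite-dimensional laws of the regularized process\<close>

context max_convolution_semigroup
begin

lemma borel_measurable_coordinate_lim [measurable]:
  "0 < t \<Longrightarrow> (\<lambda>\<omega>. \<omega> t) \<in> borel_measurable K.lim"
  by (rule borel_measurable_coordinate[OF K.sets_lim]) simp

lemma prod_upper_value_singleton:
  "(\<Prod>s\<in>{t}. upper_value H {t} x s powr gap {t} s) = H (x t) powr t"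
proof -
  have less: "{u \<in> {t}. u < t} = {}" and le: "{u \<in> {t}. t \<le> u} = {t}" by auto
  have "gap {t} t = t" unfolding gap_def less by simp
  moreover have "upper_value H {t} x t = H (x t)" unfolding upper_value_def le by simp
  ultimately show ?thesis by simp
qed

lemma measure_lim_coordinate:
  "0 < t \<Longrightarrow> measure K.lim {\<omega> \<in> space K.lim. \<omega> t \<le> x} = H x powr t"
  using measure_lim_atMost[of "{t}" "\<lambda>_. x"] unfolding prod_upper_value_singleton by simp

text \<open>There are only countably many pairs of rational times, each with its own null
  set.\<close>

lemma AE_mono_on_rats: "AE \<omega> in K.lim. mono_on (\<rat> \<inter> {0<..}) \<omega>"
proof -
  have Q: "countable (\<rat> \<inter> {0::real<..})" by (simp add: countable_rat countable_Int1)
  have "AE \<omega> in K.lim. \<forall>p\<in>\<rat> \<inter> {0<..}. \<forall>q\<in>\<rat> \<inter> {0<..}. p \<le> q \<longrightarrow> \<omega> p \<le> \<omega> q"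
    unfolding AE_ball_countable[OF Q] by (auto intro: AE_lim_mono)
  then show ?thesis by (rule AE_mp) (auto simp: monotone_on_def)
qed

lemma AE_le_regularize:
  assumes "0 < t"
  shows "AE \<omega> in K.lim. \<omega> t \<le> regularize \<omega> t"
proof -
  have Q: "countable (\<rat> \<inter> {t<..})" by (simp add: countable_rat countable_Int1)
  have "AE \<omega> in K.lim. \<forall>q\<in>\<rat> \<inter> {t<..}. \<omega> t \<le> \<omega> q"
    unfolding AE_ball_countable[OF Q] using assms by (auto intro: AE_lim_mono)
  with AE_mono_on_rats show ?thesis
    by eventually_elim (auto intro!: regularize_greatest)
qed

lemma borel_measurable_regularize_lim [measurable]:
  "0 < t \<Longrightarrow> (\<lambda>\<omega>. regularize \<omega> t) \<in> borel_measurable K.lim"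
  by (rule borel_measurable_regularize[where T = "\<lambda>_. t"]) auto

text \<open>Up to null sets \<open>{Y(t) \<le> x}\<close> is contained in \<open>{\<omega>(t) \<le> x}\<close> and contains \<open>{\<omega>(q) \<le> x}\<close> for
  every rational \<open>q > t\<close>, and the probabilities of the latter tend to that of \<open>{\<omega>(t) \<le> x}\<close>.\<close>

lemma AE_regularize_le_iff:
  assumes t: "0 < t"
  shows "AE \<omega> in K.lim. regularize \<omega> t \<le> x \<longleftrightarrow> \<omega> t \<le> x"
proof -
  let ?A = "{\<omega> \<in> space K.lim. regularize \<omega> t \<le> x}" and ?B = "{\<omega> \<in> space K.lim. \<omega> t \<le> x}"
  have sets [measurable]: "?A \<in> sets K.lim" "?B \<in> sets K.lim"
    using t by (auto intro!: sets_Collect_le_euclidean simp del: K.space_lim K.sets_lim)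
  have AB: "measure K.lim (?B \<inter> ?A) = measure K.lim ?A"
    using AE_le_regularize[OF t]
    by (intro K.P.finite_measure_eq_AE) (auto intro: order_trans simp del: K.space_lim K.sets_lim)
  have "measure K.lim ?B \<le> measure K.lim ?A"
    unfolding measure_lim_coordinate[OF t]
  proof (rule powr_le_of_rats_greater)
    fix q :: real assume q: "q \<in> \<rat>" "t < q"
    then have "0 < q" using t by simp
    show "H x powr q \<le> measure K.lim ?A"
      unfolding measure_lim_coordinate[OF \<open>0 < q\<close>, symmetric]
    proof (rule K.P.finite_measure_mono_AE)
      show "AE \<omega> in K.lim. \<omega> \<in> {\<omega> \<in> space K.lim. \<omega> q \<le> x} \<longrightarrow> \<omega> \<in> ?A"
        using AE_mono_on_rats
        by eventually_elim (use t q in \<open>auto intro: order_trans[OF regularize_le]\<close>)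
    qed (rule sets)
  qed simp
  \<comment> \<open>\<open>?A\<close> lies in \<open>?B\<close> almost surely and is at least as
    probable, so the difference is null.\<close>
  then have "measure K.lim (?B - ?A) = 0"
    using K.P.finite_measure_Diff'[OF sets(2,1)] AB K.P.finite_measure_mono[of "?B \<inter> ?A" ?B]
      measure_nonneg[of K.lim "?B - ?A"] sets by linarith
  then have "AE \<omega> in K.lim. \<omega> \<notin> ?B - ?A"
    by (subst (asm) K.P.prob_eq_0) (use sets in auto)
  with AE_le_regularize[OF t] AE_space show ?thesis
    by eventually_elim (auto intro: order_trans)
qed

text \<open>For finitely many times the exceptional null sets combine, so the law of the
  unregularized path carries over.\<close>

lemma measure_regularize_atMost:
  assumes J: "finite J" "J \<subseteq> {0<..}"
  shows "measure K.lim {\<omega> \<in> space K.lim. \<forall>t\<in>J. regularize \<omega> t \<le> x t} =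
    (\<Prod>s\<in>J. upper_value H J x s powr gap J s)"
  unfolding measure_lim_atMost[OF J, symmetric]
proof (rule K.P.finite_measure_eq_AE)
  have "AE \<omega> in K.lim. \<forall>t\<in>J. regularize \<omega> t \<le> x t \<longleftrightarrow> \<omega> t \<le> x t"
    using J by (subst AE_ball_countable) (auto intro: countable_finite AE_regularize_le_iff)
  then show "AE \<omega> in K.lim. \<omega> \<in> {\<omega> \<in> space K.lim. \<forall>t\<in>J. regularize \<omega> t \<le> x t} \<longleftrightarrow>
      \<omega> \<in> {\<omega> \<in> space K.lim. \<forall>t\<in>J. \<omega> t \<le> x t}"
    by eventually_elim auto
qed (use J in \<open>auto intro!: sets_Collect_ball_le simp del: K.space_lim K.sets_lim\<close>)

end

text \<open>The auxiliary value \<open>t 0 = 0\<close> matches the 0 inserted in \<open>gap\<close>,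
  which settles \<open>k = 1\<close>.\<close>

lemma gap_strict_mono:
  fixes t :: "nat \<Rightarrow> real"
  assumes t0: "t 0 = 0" and t: "strict_mono_on {0..m} t" and k: "k \<in> {1..m}"
  shows "gap (t ` {1..m}) (t k) = t k - t (k - 1)"
proof -
  have less_iff: "t i < t j \<longleftrightarrow> i < j" if "i \<in> {0..m}" "j \<in> {0..m}" for i j
    using t that by (rule strict_mono_on_less)
  have "Max (insert 0 {u \<in> t ` {1..m}. u < t k}) = t (k - 1)"
  proof (rule Max_eqI)
    show "y \<le> t (k - 1)" if "y \<in> insert 0 {u \<in> t ` {1..m}. u < t k}" for y
    proof -
      from that t0 obtain i where "y = t i" "i \<in> {0..m}" "i < k"
        using k by (force simp: less_iff)
      moreover from this k have "t i \<le> t (k - 1)"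
        by (subst strict_mono_on_less_eq[OF t]) auto
      ultimately show ?thesis by simp
    qed
    show "t (k - 1) \<in> insert 0 {u \<in> t ` {1..m}. u < t k}"
    proof (cases "k = 1")
      case False
      with k have "k - 1 \<in> {1..m}" "t (k - 1) < t k" by (auto simp: less_iff)
      then show ?thesis by auto
    qed (simp add: t0)
  qed simp
  then show ?thesis by (simp add: gap_def)
qed

text \<open>Reindexes the product over a set of times into the form that
  \<open>extremal_process\<close> demands.\<close>

lemma (in max_convolution_semigroup) measure_regularize_times:
  fixes t :: "nat \<Rightarrow> real"
  assumes t0: "t 0 = 0" and t: "strict_mono_on {0..m} t"
  shows "measure K.lim {\<omega> \<in> space K.lim. \<forall>k\<in>{1..m}. regularize \<omega> (t k) \<le> x k} =
    (\<Prod>k=1..m. H (Inf_fin (x ` {k..m})) powr (t k - t (k - 1)))"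
proof -
  let ?J = "t ` {1..m}"
  have inj: "inj_on t {1..m}"
    using strict_mono_on_imp_inj_on[OF t] by (rule inj_on_subset) auto
  \<comment> \<open>The bounds are transported from indices to times along the injective
    \<open>t\<close>.\<close>
  define y where "y u = x (the_inv_into {1..m} t u)" for u
  have y: "y (t k) = x k" if "k \<in> {1..m}" for k
    unfolding y_def using the_inv_into_f_f[OF inj that] by simp
  have "?J \<subseteq> {0<..}"
    using strict_mono_onD[OF t, of 0] t0 by auto
  then have "measure K.lim {\<omega> \<in> space K.lim. \<forall>u\<in>?J. regularize \<omega> u \<le> y u} =
      (\<Prod>u\<in>?J. upper_value H ?J y u powr gap ?J u)"
    by (intro measure_regularize_atMost) auto
  also have "\<dots> = (\<Prod>k=1..m. upper_value H ?J y (t k) powr gap ?J (t k))"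
    by (subst prod.reindex[OF inj]) (simp only: comp_def)
  also have "\<dots> = (\<Prod>k=1..m. H (Inf_fin (x ` {k..m})) powr (t k - t (k - 1)))"
  proof (rule prod.cong[OF refl])
    fix k assume k: "k \<in> {1..m}"
    have le_iff: "t k \<le> t j \<longleftrightarrow> k \<le> j" if "j \<in> {1..m}" for j
      using k that by (intro strict_mono_on_less_eq[OF t]) auto
    have "{u \<in> ?J. t k \<le> u} = t ` {k..m}" using k by (force simp: le_iff)
    moreover have "y ` t ` {k..m} = x ` {k..m}"
      using k by (auto simp: image_image y intro!: image_cong)
    moreover have "\<exists>u\<in>?J. t k \<le> u" using k by auto
    ultimately have "upper_value H ?J y (t k) = H (Inf_fin (x ` {k..m}))"
      by (simp add: upper_value_def)
    then show "upper_value H ?J y (t k) powr gap ?J (t k)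
        = H (Inf_fin (x ` {k..m})) powr (t k - t (k - 1))"
      using gap_strict_mono[OF t0 t k] by simp
  qed
  finally show ?thesis by (simp add: y)
qed

lemma (in max_convolution_semigroup) measure_regularize_coordinate:
  "0 < t \<Longrightarrow> measure K.lim {\<omega> \<in> space K.lim. regularize \<omega> t \<le> x} = H x powr t"
  using measure_regularize_atMost[of "{t}" "\<lambda>_. x"] unfolding prod_upper_value_singleton by simp

subsection \<open>The process at an independent random time\<close>

lemma distr_pair_snd:
  assumes "prob_space L" "sigma_finite_measure N"
  shows "distr (L \<Otimes>\<^sub>M N) N snd = N"
proof (rule measure_eqI)
  interpret L: prob_space L by fact
  interpret N: sigma_finite_measure N by fact
  fix A assume A: "A \<in> sets (distr (L \<Otimes>\<^sub>M N) N snd)"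
  then have "emeasure (distr (L \<Otimes>\<^sub>M N) N snd) A = emeasure (L \<Otimes>\<^sub>M N) (space L \<times> A)"
    by (auto simp: emeasure_distr space_pair_measure dest: sets.sets_into_space
        intro!: arg_cong[where f = "emeasure _"])
  with A show "emeasure (distr (L \<Otimes>\<^sub>M N) N snd) A = emeasure N A"
    by (simp add: N.emeasure_pair_measure_Times L.emeasure_space_1)
qed simp

text \<open>Adjoining an independent coordinate changes no probability, since the first marginal of
  the product is \<open>L\<close>.\<close>

lemma extremal_process_pair:
  fixes Y :: "real \<Rightarrow> 'w \<Rightarrow> real^'d"
  assumes Y: "extremal_process L H Y" and N: "prob_space N"
  shows "extremal_process (L \<Otimes>\<^sub>M N) H (\<lambda>t p. Y t (fst p))"
proof -
  interpret L: prob_space L using Y by (simp add: extremal_process_def)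
  interpret N: prob_space N by fact
  interpret LN: pair_prob_space L N ..
  have meas: "Y t \<in> borel_measurable L" if "0 < t" for t
    using Y that by (simp add: extremal_process_def)
  have "measure (L \<Otimes>\<^sub>M N) {p \<in> space (L \<Otimes>\<^sub>M N). \<forall>k\<in>{1..m}. Y (t k) (fst p) \<le> x k} =
      measure L {\<omega> \<in> space L. \<forall>k\<in>{1..m}. Y (t k) \<omega> \<le> x k}"
    if t: "t 0 = 0" "strict_mono_on {0..m} t" for m :: nat and t and x :: "nat \<Rightarrow> real^'d"
  proof -
    have "0 < t k" if "k \<in> {1..m}" for k
      using strict_mono_onD[OF t(2), of 0 k] t(1) that by auto
    then have "{\<omega> \<in> space L. \<forall>k\<in>{1..m}. Y (t k) \<omega> \<le> x k} \<in> sets L"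
      by (intro sets_Collect_ball_le meas) auto
    then have "measure (distr (L \<Otimes>\<^sub>M N) L fst) {\<omega> \<in> space L. \<forall>k\<in>{1..m}. Y (t k) \<omega> \<le> x k}
        = measure (L \<Otimes>\<^sub>M N) {p \<in> space (L \<Otimes>\<^sub>M N). \<forall>k\<in>{1..m}. Y (t k) (fst p) \<le> x k}"
      by (auto simp: measure_distr space_pair_measure intro!: arg_cong[where f = "measure _"])
    then show ?thesis by (simp add: N.distr_pair_fst)
  qed
  with Y show ?thesis
    unfolding extremal_process_def
    by (auto simp: LN.prob_space_axioms space_pair_measure intro!: measurable_compose[OF measurable_fst])
qed

text \<open>Events of \<open>Z\<close> are preimages under \<open>snd\<close>, those of the process
  are preimages under \<open>fst\<close>, and the product measure of a rectangle factors.\<close>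

lemma independent_of_process_pair:
  fixes Y :: "real \<Rightarrow> 'w \<Rightarrow> real^'d"
  assumes "prob_space L" "prob_space N" and Z: "Z \<in> borel_measurable N"
    and Y: "\<And>t. 0 < t \<Longrightarrow> Y t \<in> borel_measurable L"
  shows "independent_of_process (L \<Otimes>\<^sub>M N) (\<lambda>p. Z (snd p)) (\<lambda>t p. Y t (fst p))"
proof -
  interpret L: prob_space L by fact
  interpret N: prob_space N by fact
  interpret LN: pair_prob_space L N ..
  let ?M = "L \<Otimes>\<^sub>M N"
  let ?\<Z> = "{(\<lambda>p. Z (snd p)) -` A \<inter> space ?M | A. A \<in> sets borel}"
  let ?\<Y> = "{(\<lambda>p. Y t (fst p)) -` B \<inter> space ?M | t B. 0 < t \<and> B \<in> sets borel}"
  \<comment> \<open>Inclusion of the generators in a pullback sigma-algebra extends to all of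
    \<open>sigma_sets\<close>, which replaces an induction over generated events.\<close>
  have "?\<Z> \<subseteq> sets (vimage_algebra (space ?M) snd N)"
  proof safe
    fix A :: "real set" assume "A \<in> sets borel"
    then have "Z -` A \<inter> space N \<in> sets N" using Z by (rule measurable_sets[rotated])
    moreover have "(\<lambda>p. Z (snd p)) -` A \<inter> space ?M = snd -` (Z -` A \<inter> space N) \<inter> space ?M"
      by (auto simp: space_pair_measure)
    ultimately show "(\<lambda>p. Z (snd p)) -` A \<inter> space ?M \<in> sets (vimage_algebra (space ?M) snd N)"
      by (simp only: in_vimage_algebra)
  qed
  from sets.sigma_sets_subset[OF this]
  have "sigma_sets (space ?M) ?\<Z> \<subseteq> sets (vimage_algebra (space ?M) snd N)" by simp
  also have "\<dots> = {snd -` A \<inter> space ?M | A. A \<in> sets N}"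
    by (rule sets_vimage_algebra2) (auto simp: space_pair_measure)
  finally have \<Z>: "sigma_sets (space ?M) ?\<Z> \<subseteq> {snd -` A \<inter> space ?M | A. A \<in> sets N}" .
  have "?\<Y> \<subseteq> sets (vimage_algebra (space ?M) fst L)"
  proof safe
    fix t :: real and B :: "(real^'d) set" assume "0 < t" "B \<in> sets borel"
    then have "Y t -` B \<inter> space L \<in> sets L" using Y by (blast intro: measurable_sets)
    moreover have "(\<lambda>p. Y t (fst p)) -` B \<inter> space ?M = fst -` (Y t -` B \<inter> space L) \<inter> space ?M"
      by (auto simp: space_pair_measure)
    ultimately show "(\<lambda>p. Y t (fst p)) -` B \<inter> space ?M \<in> sets (vimage_algebra (space ?M) fst L)"
      by (simp only: in_vimage_algebra)
  qed
  from sets.sigma_sets_subset[OF this]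
  have "sigma_sets (space ?M) ?\<Y> \<subseteq> sets (vimage_algebra (space ?M) fst L)" by simp
  also have "\<dots> = {fst -` B \<inter> space ?M | B. B \<in> sets L}"
    by (rule sets_vimage_algebra2) (auto simp: space_pair_measure)
  finally have \<Y>: "sigma_sets (space ?M) ?\<Y> \<subseteq> {fst -` B \<inter> space ?M | B. B \<in> sets L}" .
  have times: "measure ?M (B \<times> A) = measure L B * measure N A" if "B \<in> sets L" "A \<in> sets N" for A B
    using that by (simp add: measure_def N.emeasure_pair_measure_Times enn2real_mult)
  have snd_eq: "snd -` A \<inter> space ?M = space L \<times> A" if "A \<in> sets N" for A
    using sets.sets_into_space[OF that] by (auto simp: space_pair_measure)
  have fst_eq: "fst -` B \<inter> space ?M = B \<times> space N" if "B \<in> sets L" for B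
    using sets.sets_into_space[OF that] by (auto simp: space_pair_measure)
  show ?thesis
    unfolding independent_of_process_def
  proof (rule LN.indep_setI)
    show "sigma_sets (space ?M) ?\<Z> \<subseteq> LN.events" using \<Z> by auto
    show "sigma_sets (space ?M) ?\<Y> \<subseteq> LN.events" using \<Y> by auto
    fix a b assume a: "a \<in> sigma_sets (space ?M) ?\<Z>" and b: "b \<in> sigma_sets (space ?M) ?\<Y>"
    obtain A where A: "A \<in> sets N" "a = space L \<times> A"
      using subsetD[OF \<Z> a] by (auto simp: snd_eq)
    obtain B where B: "B \<in> sets L" "b = B \<times> space N"
      using subsetD[OF \<Y> b] by (auto simp: fst_eq)
    from A B have "a \<inter> b = B \<times> A"
      using sets.sets_into_space[OF A(1)] sets.sets_into_space[OF B(1)] by auto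
    with A B show "LN.prob (a \<inter> b) = LN.prob a * LN.prob b"
      by (simp add: times L.prob_space N.prob_space)
  qed
qed

text \<open>A real distribution is determined by its \<open>cdf\<close>; this identifies the
  Lebesgue--Stieltjes measure of \<open>G\<close> with the given law.\<close>

lemma (in real_distribution) interval_measure_cdf: "interval_measure (cdf M) = M"
proof (rule cdf_unique)
  show "real_distribution (interval_measure (cdf M))"
    by (intro real_distribution_interval_measure cdf_nondecreasing cdf_is_right_cont
        cdf_lim_at_bot cdf_lim_at_top_prob)
  show "cdf (interval_measure (cdf M)) = cdf M"
    by (intro cdf_interval_measure cdf_nondecreasing cdf_is_right_cont cdf_lim_at_bot)
qed (rule real_distribution_axioms)

text \<open>Almost sure positivity makes the indicator of \<open>{0..}\<close> equal to 1 almost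
  everywhere.\<close>

lemma (in real_distribution) laplace_transform_cdf:
  assumes "AE z in M. 0 < z"
  shows "laplace_transform (cdf M) v = (LINT z|M. exp (- v * z))"
  unfolding laplace_transform_def interval_measure_cdf set_lebesgue_integral_def
  using assms by (intro integral_cong_AE) auto

text \<open>Tonelli over the second coordinate; the section probabilities \<open>f\<close> inherit
  their measurability from the event.\<close>

lemma measure_pair_eq_integral:
  assumes "prob_space L" "prob_space N"
    and meas: "{p \<in> space (L \<Otimes>\<^sub>M N). Q (fst p) (snd p)} \<in> sets (L \<Otimes>\<^sub>M N)"
    and f: "\<And>z. z \<in> space N \<Longrightarrow> measure L {\<omega> \<in> space L. Q \<omega> z} = f z"
  shows "measure (L \<Otimes>\<^sub>M N) {p \<in> space (L \<Otimes>\<^sub>M N). Q (fst p) (snd p)} = (LINT z|N. f z)"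
proof -
  interpret L: prob_space L by fact
  interpret N: prob_space N by fact
  interpret LN: pair_prob_space L N ..
  let ?A = "{p \<in> space (L \<Otimes>\<^sub>M N). Q (fst p) (snd p)}"
  have slice: "(\<lambda>\<omega>. (\<omega>, z)) -` ?A = {\<omega> \<in> space L. Q \<omega> z}" if "z \<in> space N" for z
    using that by (auto simp: space_pair_measure)
  have "(\<lambda>z. measure L ((\<lambda>\<omega>. (\<omega>, z)) -` ?A)) \<in> borel_measurable N"
    unfolding measure_def using LN.measurable_emeasure_Pair2[OF meas] by measurable
  then have f_meas: "f \<in> borel_measurable N"
    by (rule measurable_cong[THEN iffD1, rotated]) (simp only: slice f)
  have f_bounds: "0 \<le> f z" "f z \<le> 1" if "z \<in> space N" for z
    using f[OF that, symmetric] by simp_all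
  have "AE z in N. 0 \<le> f z" by (rule AE_I2) (rule f_bounds)
  have "integrable N f"
    by (rule N.integrable_const_bound[where B = 1]) (use f_bounds f_meas in auto)
  have "emeasure (L \<Otimes>\<^sub>M N) ?A = (\<integral>\<^sup>+z. emeasure L ((\<lambda>\<omega>. (\<omega>, z)) -` ?A) \<partial>N)"
    by (rule LN.emeasure_pair_measure_alt2[OF meas])
  also have "\<dots> = (\<integral>\<^sup>+z. ennreal (f z) \<partial>N)"
    by (rule nn_integral_cong) (simp only: slice L.emeasure_eq_measure f)
  also have "\<dots> = ennreal (LINT z|N. f z)"
    by (rule nn_integral_eq_integral) fact+
  finally show ?thesis
    using integral_nonneg_AE[OF \<open>AE z in N. 0 \<le> f z\<close>] by (simp add: LN.emeasure_eq_measure)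
qed

theorem theorem2:
  fixes G \<phi> :: "real \<Rightarrow> real"
    and H F :: "real^'d \<Rightarrow> real"
  assumes "CARD('d) \<ge> 2"
    and "positive_distribution_function G"
    and "\<And>v. v \<ge> 0 \<Longrightarrow> \<phi> v = laplace_transform G v"
    and "max_infinitely_divisible H"
    and "F = mixture \<phi> H"
  shows "\<exists>(M :: ((real \<Rightarrow> real^'d) \<times> real) measure)
            (Y :: real \<Rightarrow> (real \<Rightarrow> real^'d) \<times> real \<Rightarrow> real^'d)
            (Z :: (real \<Rightarrow> real^'d) \<times> real \<Rightarrow> real).
           prob_space M \<and>
           extremal_process M H Y \<and>
           Z \<in> borel_measurable M \<and>
           (\<forall>\<omega>\<in>space M. Z \<omega> > 0) \<and>
           independent_of_process M Z Y \<and>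
           cdf (distr M borel Z) = G \<and>
           (\<forall>v\<ge>0. (LINT \<omega>|M. exp (- v * Z \<omega>)) = \<phi> v) \<and>
           (\<lambda>\<omega>. Y (Z \<omega>) \<omega>) \<in> borel_measurable M \<and>
           (\<forall>x. F x = measure M {\<omega> \<in> space M. Y (Z \<omega>) \<omega> \<le> x})"
proof -
  obtain N where N: "real_distribution N" "AE z in N. 0 < z" "G = cdf N"
    using assms(2) by (auto simp: positive_distribution_function_def)
  interpret N: real_distribution N by fact
  \<comment> \<open>Max-infinite divisibility provides the laws for \<open>s > 0\<close>; a point
    mass fills in the rest, so that the family is total.\<close>
  have "\<forall>s. \<exists>\<nu> :: (real^'d) measure. prob_space \<nu> \<and> sets \<nu> = sets borel \<and>
      (0 < s \<longrightarrow> (\<forall>x. measure \<nu> {..x} = H x powr s))"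
  proof
    fix s :: real
    show "\<exists>\<nu> :: (real^'d) measure. prob_space \<nu> \<and> sets \<nu> = sets borel \<and>
        (0 < s \<longrightarrow> (\<forall>x. measure \<nu> {..x} = H x powr s))"
    proof (cases "0 < s")
      case True
      then have "distribution_function (\<lambda>x. H x powr s)"
        using assms(4) by (simp add: max_infinitely_divisible_def)
      then show ?thesis unfolding distribution_function_def by metis
    next
      case False
      then show ?thesis by (intro exI[of _ "return borel 0"]) (simp add: prob_space_return)
    qed
  qed
  from choice[OF this] obtain \<mu> :: "real \<Rightarrow> (real^'d) measure" where
    "\<And>s. prob_space (\<mu> s)" "\<And>s. sets (\<mu> s) = sets borel"
    "\<And>s x. 0 < s \<Longrightarrow> measure (\<mu> s) {..x} = H x powr s"
    by blast
  then interpret S: max_convolution_semigroup \<mu> H by (rule max_convolution_semigroup.intro)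
  have H: "0 \<le> H x" "H x \<le> 1" for x
    using assms(4) unfolding max_infinitely_divisible_def distribution_function_def
    by (auto simp: prob_space.prob_le_1)

  let ?L = "S.K.lim"
  let ?M = "?L \<Otimes>\<^sub>M N"
  \<comment> \<open>\<open>Z\<close> must be positive everywhere, while \<open>N\<close> gives this
    only almost everywhere; the value 1 on the null set is arbitrary and leaves the law
    unchanged.\<close>
  define pos where "pos z = (if 0 < z then z else 1)" for z :: real
  have pos_gt: "0 < pos z" for z by (simp add: pos_def)
  have pos [measurable]: "pos \<in> borel_measurable N"
    unfolding pos_def by measurable
  have AE_pos: "AE z in N. pos z = z" using N(2) by eventually_elim (simp add: pos_def)
  interpret LN: pair_prob_space ?L N ..
  let ?Y = "\<lambda>t p. regularize (fst p) t" and ?Z = "\<lambda>p. pos (snd p)"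

  have "extremal_process ?L H (\<lambda>t \<omega>. regularize \<omega> t)"
    unfolding extremal_process_def
    by (intro conjI allI impI ballI S.K.P.prob_space_axioms S.borel_measurable_regularize_lim
        mono_on_regularize continuous_at_right_regularize S.measure_regularize_times)
      simp_all
  then have Y: "extremal_process ?M H ?Y"
    by (rule extremal_process_pair) (rule N.prob_space_axioms)
  have Z: "?Z \<in> borel_measurable ?M" by measurable
  have indep: "independent_of_process ?M ?Z ?Y"
    by (rule independent_of_process_pair[OF S.K.P.prob_space_axioms N.prob_space_axioms pos])
      (rule S.borel_measurable_regularize_lim)
  \<comment> \<open>The second marginal of the product is \<open>N\<close>, and \<open>pos\<close>
    is the identity almost everywhere.\<close>
  have "distr ?M borel ?Z = distr (distr ?M N snd) borel pos"
    by (subst distr_distr) (auto simp: comp_def)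
  also have "\<dots> = distr N borel pos"
    by (simp add: distr_pair_snd S.K.P.prob_space_axioms N.sigma_finite_measure_axioms)
  also have "\<dots> = distr N N (\<lambda>z. z)"
    using AE_pos by (intro distr_cong_AE) auto
  finally have distr_Z: "distr ?M borel ?Z = N" by (simp add: distr_id)
  then have cdf_Z: "cdf (distr ?M borel ?Z) = G" by (simp only: N(3))
  have \<phi>: "\<phi> v = (LINT z|N. exp (- v * z))" if "0 \<le> v" for v
    using assms(3)[OF that] N.laplace_transform_cdf[OF N(2)] by (simp add: N(3))
  have laplace: "(LINT \<omega>|?M. exp (- v * ?Z \<omega>)) = \<phi> v" if "0 \<le> v" for v
  proof -
    have "(LINT \<omega>|?M. exp (- v * ?Z \<omega>)) = (LINT z|distr ?M borel ?Z. exp (- v * z))"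
      by (subst integral_distr) (use Z in auto)
    then show ?thesis by (simp add: distr_Z \<phi>[OF that])
  qed
  have YZ: "(\<lambda>p. ?Y (?Z p) p) \<in> borel_measurable ?M"
    by (rule borel_measurable_regularize[where X = "\<lambda>q p. fst p q"])
      (auto simp: pos_gt intro!: measurable_compose[OF measurable_fst] Z)
  have mix: "F x = measure ?M {p \<in> space ?M. ?Y (?Z p) p \<le> x}" for x
  proof -
    have "{p \<in> space ?M. ?Y (?Z p) p \<le> x} \<in> sets ?M"
      using YZ by (intro sets_Collect_le_euclidean) auto
    \<comment> \<open>For fixed \<open>z\<close> the section has the one-time probability of the
      process at time \<open>pos z\<close>.\<close>
    then have "measure ?M {p \<in> space ?M. ?Y (?Z p) p \<le> x} = (LINT z|N. H x powr pos z)"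
      by (intro measure_pair_eq_integral[where Q = "\<lambda>\<omega> z. regularize \<omega> (pos z) \<le> x"]
          S.measure_regularize_coordinate pos_gt S.K.P.prob_space_axioms N.prob_space_axioms)
    also have "\<dots> = (LINT z|N. H x powr z)"
      using AE_pos by (intro integral_cong_AE) auto
    also have "\<dots> = F x"
    \<comment> \<open>Where \<open>H x = 0\<close> both sides vanish, by the convention in
      \<open>mixture\<close>. Otherwise \<open>H x \<le> 1\<close> puts \<open>- ln (H x)\<close> in
      the range where \<open>\<phi>\<close> is the Laplace transform.\<close>
    proof (cases "H x = 0")
      case False
      with H[of x] have "0 \<le> - ln (H x)" by simp
      with False show ?thesis
        by (simp add: assms(5) mixture_def \<phi> powr_def mult.commute)
    qed (simp add: assms(5) mixture_def)
    finally show ?thesis ..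
  qed
  show ?thesis
    by (intro exI[of _ ?M] exI[of _ ?Y] exI[of _ ?Z] conjI allI impI ballI
        LN.prob_space_axioms Y Z pos_gt indep cdf_Z laplace YZ mix)
qed

end
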